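(* Let $t=2m'+1\ge3$ be odd, $r\ge2$, and fix $\Lambda$ and $X$; put the matrix $M(\Lambda,X)$ in the interval form described in the context. Let $B$ be one of its blocks, with rows indexed $1,\dots,n$, and let $$\partial:\mathbb Z^n\to\mathbb Z^{n+1},\qquad\partial(x_1,\dots,x_n)=(x_1,\ x_2-x_1,\ \dots,\ x_n-x_{n-1},\ -x_n).$$ Then $\partial$ is injective and identifies $\mathbb Z^n$ with the root lattice $A_n=\{y\in\mathbb Z^{n+1}:\sum_iy_i=0\}$, with inverse $x_k=y_1+\dots+y_k$; and $\partial\,\mathbf 1_{[a,b]}=e_a-e_{b+1}$ for the indicator of an interval. Write $\alpha:=1$, $\omega:=n+1$ and $v_2,\dots,v_n$ for the remaining coordinates. Every nonzero column of $B$ is a proper prefix $[1,k]$, a proper suffix $[k+1,n]$ or the full interval $[1,n]$, and $\partial$ sends these to the edges $\alpha v_{k+1}$, $v_{k+1}\omega$ and $\alpha\omega$ respectively, while a zero column becomes a loop. So the columns of $B$ are the oriented edges of a multigraph $G_B$ on $\{\alpha,v_2,\dots,v_n,\omega\}$ whose non-loop part satisfies $$G_B\setminus\{\text{loops}\}\subseteq K_{2,n-1}+\alpha\omega,$$ with parallel edges allowed; the loops are exactly the zero columns. The column matroid of $B$ is the cycle matroid of $G_B$; in particular $B$ has linearly independent columns if and only if $G_B$ is a forest.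
   Context: Let $R'=m'+r$, $\Lambda=(\Lambda_1\ge\dots\ge\Lambda_{R'}\ge0)$ integers, $X\in\mathbb Z^r$, $V_i=2\Lambda_i+2(R'-i)+1$. The folded class of an integer $a$ is the unique $c\in\{0,\dots,m'\}$ with $a\equiv\pm c\pmod t$; its folding sign is $+1$ if $a\equiv c\pmod t$ and $-1$ otherwise. $M(\Lambda,X)$ is the $R'\times R'$ matrix with rows $i=1,\dots,R'$ and $m'$ frozen columns followed by $r$ free columns. The $p$-th frozen column ($1\le p\le m'$) has in row $i$ the folding sign of $V_i$ if $V_i$ has folded class $m'-p+1$, else $0$. The $j$-th free column ($1\le j\le r$) has in row $i$ the sum of those $\varepsilon\in\{\pm1\}$ with $\varepsilon V_i=X_j+tk$ for some odd integer $k\ge1$ ($0$ if none). Interval form: let $c_i,\sigma_i$ be the folded class and folding sign of $V_i$, $w_i=\sigma_iV_i$; for a free column $j$ let $b_j,\tau_j$ be the folded class and folding sign of $X_j$ (so $\tau_j=+1$ if $b_j=0$), and $\tau_j=+1$ for frozen columns. Multiply the entry in row $i$, column $j$ by $\sigma_i\tau_j$ and order rows by $(c_i,w_i)$ increasing lexicographically. The result is a $0/1$ matrix with consecutive ones in each column, block diagonal with one block per class $c\in\{0,\dots,m'\}$: the rows with $c_i=c$ and the columns consisting of the frozen column asking for class $c$ (if $c\ge1$) and the free columns with $b_j=c$. Blocks need not be square. $K_{2,n-1}+\alpha\omega$ is the complete bipartite graph with parts $\{\alpha,\omega\}$ and $\{v_2,\dots,v_n\}$ together with the edge $\alpha\omega$.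 Loops and pairs of parallel edges count as cycles. *)

theory Defs
  imports
    "HOL-Number_Theory.Cong"
    "HOL-Library.Product_Lexorder"
    "Jordan_Normal_Form.DL_Submatrix"
    "Graph_Theory.Digraph"
begin

text \<open>
  \<^bold>\<open>Conventions.\<close> The families \<open>\<Lambda>\<close> and \<open>X\<close> are functions on \<open>nat\<close> of which only the
  arguments \<open>1, \<dots>, m + r\<close> and \<open>1, \<dots>, r\<close> matter; \<open>m\<close> stands for \<open>m'\<close>. Row and column numbers of
  the big matrix and coordinates of vectors are counted from 1 in the formulas below, whereas
  the types \<open>mat\<close> and \<open>vec\<close> count positions from 0, so position \<open>a\<close> holds row, column or
  coordinate \<open>Suc a\<close>.
\<close>

section \<open>The matrix \<open>M(\<Lambda>,X)\<close> and its blocks\<close>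

definition modulus :: "nat \<Rightarrow> int" where
  "modulus m = 2 * int m + 1"

definition folded_class :: "nat \<Rightarrow> int \<Rightarrow> nat" where
  "folded_class m a =
     (THE c. c \<le> m \<and> ([a = int c] (mod modulus m) \<or> [a = - int c] (mod modulus m)))"

definition folding_sign :: "nat \<Rightarrow> int \<Rightarrow> int" where
  "folding_sign m a = (if [a = int (folded_class m a)] (mod modulus m) then 1 else - 1)"

definition V :: "nat \<Rightarrow> nat \<Rightarrow> (nat \<Rightarrow> int) \<Rightarrow> nat \<Rightarrow> int" where
  "V m r \<Lambda> i = 2 * \<Lambda> i + 2 * (int (m + r) - int i) + 1"

definition frozen_entry :: "nat \<Rightarrow> nat \<Rightarrow> (nat \<Rightarrow> int) \<Rightarrow> nat \<Rightarrow> nat \<Rightarrow> int" where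
  "frozen_entry m r \<Lambda> i p =
     (if folded_class m (V m r \<Lambda> i) = m - p + 1 then folding_sign m (V m r \<Lambda> i) else 0)"

definition free_entry :: "nat \<Rightarrow> nat \<Rightarrow> (nat \<Rightarrow> int) \<Rightarrow> (nat \<Rightarrow> int) \<Rightarrow> nat \<Rightarrow> nat \<Rightarrow> int" where
  "free_entry m r \<Lambda> X i j =
     (\<Sum>\<epsilon> | \<epsilon> \<in> {1, - 1} \<and> (\<exists>k::int. odd k \<and> k \<ge> 1 \<and> \<epsilon> * V m r \<Lambda> i = X j + modulus m * k). \<epsilon>)"

text \<open>Columns \<open>1, \<dots>, m\<close> are the frozen ones; column \<open>m + j\<close> is the \<open>j\<close>-th free one.\<close>

definition big_matrix :: "nat \<Rightarrow> nat \<Rightarrow> (nat \<Rightarrow> int) \<Rightarrow> (nat \<Rightarrow> int) \<Rightarrow> int mat" where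
  "big_matrix m r \<Lambda> X = mat (m + r) (m + r) (\<lambda>(a, b).
     if Suc b \<le> m then frozen_entry m r \<Lambda> (Suc a) (Suc b)
     else free_entry m r \<Lambda> X (Suc a) (Suc b - m))"

definition row_class :: "nat \<Rightarrow> nat \<Rightarrow> (nat \<Rightarrow> int) \<Rightarrow> nat \<Rightarrow> nat" where
  "row_class m r \<Lambda> i = folded_class m (V m r \<Lambda> i)"

definition row_sign :: "nat \<Rightarrow> nat \<Rightarrow> (nat \<Rightarrow> int) \<Rightarrow> nat \<Rightarrow> int" where
  "row_sign m r \<Lambda> i = folding_sign m (V m r \<Lambda> i)"

definition row_weight :: "nat \<Rightarrow> nat \<Rightarrow> (nat \<Rightarrow> int) \<Rightarrow> nat \<Rightarrow> int" where
  "row_weight m r \<Lambda> i = row_sign m r \<Lambda> i * V m r \<Lambda> i"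

text \<open>The class of the frozen column \<open>p\<close> is the class \<open>m - p + 1\<close> it asks for.\<close>

definition col_class :: "nat \<Rightarrow> (nat \<Rightarrow> int) \<Rightarrow> nat \<Rightarrow> nat" where
  "col_class m X q = (if q \<le> m then m - q + 1 else folded_class m (X (q - m)))"

definition col_sign :: "nat \<Rightarrow> (nat \<Rightarrow> int) \<Rightarrow> nat \<Rightarrow> int" where
  "col_sign m X q = (if q \<le> m then 1 else folding_sign m (X (q - m)))"

definition row_order :: "nat \<Rightarrow> nat \<Rightarrow> (nat \<Rightarrow> int) \<Rightarrow> nat list" where
  "row_order m r \<Lambda> =
     sort_key (\<lambda>i. (row_class m r \<Lambda> i, row_weight m r \<Lambda> i)) [1..<m + r + 1]"

definition interval_form :: "nat \<Rightarrow> nat \<Rightarrow> (nat \<Rightarrow> int) \<Rightarrow> (nat \<Rightarrow> int) \<Rightarrow> int mat" where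
  "interval_form m r \<Lambda> X = mat (m + r) (m + r) (\<lambda>(a, b).
     let i = row_order m r \<Lambda> ! a in
       row_sign m r \<Lambda> i * col_sign m X (Suc b) * big_matrix m r \<Lambda> X $$ (i - 1, b))"

text \<open>A block may have no rows or no columns. Its columns keep their order in \<open>M(\<Lambda>,X)\<close>.\<close>

definition interval_block :: "nat \<Rightarrow> nat \<Rightarrow> (nat \<Rightarrow> int) \<Rightarrow> (nat \<Rightarrow> int) \<Rightarrow> nat \<Rightarrow> int mat" where
  "interval_block m r \<Lambda> X c = submatrix (interval_form m r \<Lambda> X)
     {a. a < m + r \<and> row_class m r \<Lambda> (row_order m r \<Lambda> ! a) = c}
     {b. b < m + r \<and> col_class m X (Suc b) = c}"

section \<open>The difference map and the root lattice\<close>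

definition bdry :: "int vec \<Rightarrow> int vec" where
  "bdry x = vec (dim_vec x + 1) (\<lambda>a.
     (if a < dim_vec x then x $ a else 0) - (if a = 0 then 0 else x $ (a - 1)))"

definition root_lattice :: "nat \<Rightarrow> int vec set" where
  "root_lattice n = {y \<in> carrier_vec (n + 1). (\<Sum>a < n + 1. y $ a) = 0}"

text \<open>Indicator vector of \<open>[a,b] \<subseteq> {1, \<dots>, n}\<close> and standard basis of \<open>\<int>\<^sup>N\<close>, both counted from 1.\<close>

definition interval_vec :: "nat \<Rightarrow> nat \<Rightarrow> nat \<Rightarrow> int vec" where
  "interval_vec n a b = vec n (\<lambda>i. if Suc i \<in> {a..b} then 1 else 0)"

definition basis_vec :: "nat \<Rightarrow> nat \<Rightarrow> int vec" where
  "basis_vec N k = unit_vec N (k - 1)"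

section \<open>Multigraphs\<close>

text \<open>
  A multigraph is a \<^typ>\<open>('v, 'e) pre_digraph\<close>, whose arcs are edges with a chosen orientation;
  loops and parallel edges are allowed. The library notions of cycle and forest refer to directed
  cycles, whereas the cycle matroid is about cycles that ignore the orientation.
\<close>

definition joins :: "('v, 'e) pre_digraph \<Rightarrow> 'e \<Rightarrow> 'v \<Rightarrow> 'v \<Rightarrow> bool" where
  "joins G e u v \<longleftrightarrow> (tail G e = u \<and> head G e = v) \<or> (tail G e = v \<and> head G e = u)"

text \<open>Length 1 gives the loops, length 2 the pairs of parallel edges.\<close>

definition undirected_cycle :: "('v, 'e) pre_digraph \<Rightarrow> 'e list \<Rightarrow> bool" where
  "undirected_cycle G es \<longleftrightarrow> es \<noteq> [] \<and> distinct es \<and> set es \<subseteq> arcs G \<and>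
     (\<exists>vs. length vs = length es \<and> distinct vs \<and>
       (\<forall>i < length es. joins G (es ! i) (vs ! i) (vs ! (Suc i mod length es))))"

definition undirected_forest :: "('v, 'e) pre_digraph \<Rightarrow> bool" where
  "undirected_forest G \<longleftrightarrow> (\<nexists>es. undirected_cycle G es)"

text \<open>Edges of \<open>K\<^bsub>2,n-1\<^esub> + \<alpha>\<omega>\<close> with \<open>\<alpha> = 1\<close>, \<open>\<omega> = n + 1\<close> and \<open>v\<^sub>k = k\<close>, as unordered pairs.\<close>

definition complete_bipartite_edges :: "'v set \<Rightarrow> 'v set \<Rightarrow> 'v set set" where
  "complete_bipartite_edges P Q = {{p, q} | p q. p \<in> P \<and> q \<in> Q}"

definition K2_plus_edges :: "nat \<Rightarrow> nat set set" where
  "K2_plus_edges n = complete_bipartite_edges {1, n + 1} {2..n} \<union> {{1, n + 1}}"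

text \<open>
  \<open>G\<close> is a graph \<open>G\<^sub>B\<close> of the matrix \<open>B\<close>: its edges are the columns of \<open>B\<close>, and the image of a column
  under the difference map is \<open>e\<^sub>u - e\<^sub>v\<close>, where \<open>u\<close> is the tail and \<open>v\<close> the head of the edge. This
  determines the ends of all edges belonging to nonzero columns, and makes every zero column a
  loop at an unspecified vertex.
\<close>

definition is_column_graph :: "int mat \<Rightarrow> (nat, nat) pre_digraph \<Rightarrow> bool" where
  "is_column_graph B G \<longleftrightarrow>
     wf_digraph G \<and> verts G = {1..dim_row B + 1} \<and> arcs G = {..<dim_col B} \<and>
     (\<forall>j < dim_col B. bdry (col B j) =
        basis_vec (dim_row B + 1) (tail G j) - basis_vec (dim_row B + 1) (head G j))"

section \<open>Matroids\<close>

text \<open>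
  A matroid is represented by its ground set and its family of independent sets. Columns are
  referred to by their positions, so that equal columns are different elements; independence of
  the family of columns is meant over the rationals.
\<close>

definition independent_columns :: "int mat \<Rightarrow> nat set \<Rightarrow> bool" where
  "independent_columns B S \<longleftrightarrow>
     (\<forall>a :: nat \<Rightarrow> rat. (\<forall>i < dim_row B. (\<Sum>j\<in>S. a j * of_int (B $$ (i, j))) = 0)
        \<longrightarrow> (\<forall>j\<in>S. a j = 0))"

definition column_matroid :: "int mat \<Rightarrow> nat set \<times> nat set set" where
  "column_matroid B = ({..<dim_col B}, {S. S \<subseteq> {..<dim_col B} \<and> independent_columns B S})"

definition cycle_matroid :: "('v, 'e) pre_digraph \<Rightarrow> 'e set \<times> 'e set set" where
  "cycle_matroid G = (arcs G, {F. F \<subseteq> arcs G \<and> (\<nexists>es. undirected_cycle G es \<and> set es \<subseteq> F)})"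

end

theory Submission
  imports Defs
begin

text \<open>
  The entry of a free column \<open>X\<^sub>j\<close> in a row of its own class is decided by comparing the signed
  row value \<open>w\<close> with a threshold: it is 1 iff \<open>X\<^sub>j\<close> is even and \<open>\<tau> * w > X\<^sub>j\<close>, or
  \<open>w > \<bar>X\<^sub>j\<bar>\<close> in class 0. As the rows of a block are sorted by \<open>w\<close>, the column is
  a suffix for \<open>\<tau> = 1\<close> and a prefix for \<open>\<tau> = - 1\<close>, and a frozen column is full. The difference map turns linear relations between columns into
  flows on the graph: a cycle carries a \<open>\<plusminus>1\<close> flow, and conversely in the support of a nonzero
  flow every vertex that is entered can be left through another edge, so an endless walk in the
  finite support closes a cycle.
\<close>

section \<open>The difference map\<close>

lemma dim_bdry [simp]: "dim_vec (bdry x) = dim_vec x + 1"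
  by (simp add: bdry_def)

lemma bdry_index:
  "a \<le> dim_vec x \<Longrightarrow>
     bdry x $ a = (if a < dim_vec x then x $ a else 0) - (if a = 0 then 0 else x $ (a - 1))"
  by (simp add: bdry_def)

lemma bdry_add: "dim_vec x = dim_vec y \<Longrightarrow> bdry (x + y) = bdry x + bdry y"
  by (rule eq_vecI) (auto simp: bdry_index)

text \<open>Telescoping; since \<open>k\<close> stays below the dimension, the final coordinate,
  where the leading term is missing, is not reached.\<close>

lemma partial_sum_bdry:
  assumes "k < dim_vec x"
  shows "(\<Sum>i\<le>k. bdry x $ i) = x $ k"
  using assms by (induction k) (simp_all add: bdry_index)

lemma bdry_in_root_lattice:
  assumes "x \<in> carrier_vec n"
  shows "bdry x \<in> root_lattice n"
proof (cases n)
  case 0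
  with assms have "dim_vec x = 0" by simp
  then show ?thesis using 0 by (auto simp: root_lattice_def bdry_index intro!: carrier_vecI)
next
  case (Suc k)
  have "(\<Sum>a<n + 1. bdry x $ a) = (\<Sum>a\<le>k. bdry x $ a) + bdry x $ n"
    using Suc by (simp add: lessThan_Suc_atMost)
  also have "\<dots> = 0"
    using Suc assms by (subst partial_sum_bdry) (auto simp: bdry_index)
  finally show ?thesis using assms by (auto simp: root_lattice_def intro!: carrier_vecI)
qed

lemma partial_sums_bdry:
  assumes "x \<in> carrier_vec n"
  shows "vec n (\<lambda>k. \<Sum>i\<le>k. bdry x $ i) = x"
  using assms by (intro eq_vecI) (auto simp: partial_sum_bdry)

lemma bdry_partial_sums:
  assumes "y \<in> root_lattice n"
  shows "bdry (vec n (\<lambda>k. \<Sum>i\<le>k. y $ i)) = y"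
proof (rule eq_vecI)
  show "dim_vec (bdry (vec n (\<lambda>k. \<Sum>i\<le>k. y $ i))) = dim_vec y"
    using assms by (auto simp: root_lattice_def)
next
  fix a assume "a < dim_vec y"
  then have "a \<le> n" and total: "(\<Sum>i<n + 1. y $ i) = 0"
    using assms by (auto simp: root_lattice_def)
  show "bdry (vec n (\<lambda>k. \<Sum>i\<le>k. y $ i)) $ a = y $ a"
  proof (cases a)
    case 0
    then show ?thesis using \<open>a \<le> n\<close> total by (auto simp: bdry_index)
  next
    case (Suc k)
    \<comment> \<open>The last coordinate of the image is minus the sum of the first
      \<open>n\<close> coordinates of \<open>y\<close>, and this is \<open>y $ n\<close> because the
      total is zero.\<close>
    have "(\<Sum>i\<le>k. y $ i) + y $ n = 0" if "a = n"
    proof -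
      have "n = Suc k" using that Suc by simp
      then show ?thesis using total by (simp add: lessThan_Suc_atMost)
    qed
    then show ?thesis using Suc \<open>a \<le> n\<close> by (auto simp: bdry_index)
  qed
qed

lemma bij_betw_bdry: "bij_betw bdry (carrier_vec n) (root_lattice n)"
  by (rule bij_betw_byWitness[where f' = "\<lambda>y. vec n (\<lambda>k. \<Sum>i\<le>k. y $ i)"])
     (auto simp: partial_sums_bdry bdry_partial_sums bdry_in_root_lattice)

lemma the_inv_into_bdry:
  assumes "y \<in> root_lattice n"
  shows "the_inv_into (carrier_vec n) bdry y = vec n (\<lambda>k. \<Sum>i\<le>k. y $ i)"
  using bij_betw_bdry bdry_partial_sums[OF assms]
  by (intro the_inv_into_f_eq) (auto simp: bij_betw_def)

lemma bdry_interval_vec: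
  assumes "1 \<le> a" "a \<le> b" "b \<le> n"
  shows "bdry (interval_vec n a b) = basis_vec (n + 1) a - basis_vec (n + 1) (b + 1)"
  using assms by (intro eq_vecI) (auto simp: bdry_index interval_vec_def basis_vec_def)

lemma bdry_eq_0_iff:
  assumes "x \<in> carrier_vec n"
  shows "bdry x = 0\<^sub>v (n + 1) \<longleftrightarrow> x = 0\<^sub>v n"
proof -
  have "bdry (0\<^sub>v n) = 0\<^sub>v (n + 1)"
    by (rule eq_vecI) (auto simp: bdry_index)
  moreover have "inj_on bdry (carrier_vec n)"
    using bij_betw_bdry by (rule bij_betw_imp_inj_on)
  ultimately show ?thesis
    using assms by (metis inj_on_eq_iff zero_carrier_vec)
qed

section \<open>Recovering the ends of an edge from a difference of basis vectors\<close>

lemma basis_vec_diff_index: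
  assumes "u \<in> {1..N}" "v \<in> {1..N}" "k < N"
  shows "(basis_vec N u - basis_vec N v) $ k = of_bool (u = Suc k) - of_bool (v = Suc k)"
  using assms by (auto simp: basis_vec_def)

text \<open>The right-hand difference is 1 at \<open>u'\<close> alone and -1 at \<open>v'\<close>
  alone, which fixes both ends. The condition \<open>u' \<noteq> v'\<close> excludes loops, whose
  images are all zero.\<close>

lemma basis_vec_diff_eq_iff:
  assumes "u \<in> {1..N}" "v \<in> {1..N}" "u' \<in> {1..N}" "v' \<in> {1..N}" "u' \<noteq> v'"
  shows "basis_vec N u - basis_vec N v = basis_vec N u' - basis_vec N v' \<longleftrightarrow> u = u' \<and> v = v'"
    (is "?l = ?r \<longleftrightarrow> _")
proof
  assume eq: "?l = ?r"
  have "of_bool (u = w) - of_bool (v = w) = (of_bool (u' = w) - of_bool (v' = w) :: int)"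
    if "w \<in> {1..N}" for w
  proof -
    have "w - 1 < N" "Suc (w - 1) = w" using that by auto
    then show ?thesis
      using arg_cong[OF eq, of "\<lambda>x. x $ (w - 1)"] basis_vec_diff_index[OF assms(1,2)]
        basis_vec_diff_index[OF assms(3,4)] by metis
  qed
  from this[of u'] this[of v'] show "u = u' \<and> v = v'"
    using assms by (auto split: if_splits simp: of_bool_def)
qed simp

lemma basis_vec_diff_eq_0_iff:
  assumes "u \<in> {1..N}" "v \<in> {1..N}"
  shows "basis_vec N u - basis_vec N v = 0\<^sub>v N \<longleftrightarrow> u = v"
proof
  assume eq: "basis_vec N u - basis_vec N v = 0\<^sub>v N"
  have "u - 1 < N" "Suc (u - 1) = u" using assms by auto
  then show "u = v"
    using arg_cong[OF eq, of "\<lambda>x. x $ (u - 1)"] basis_vec_diff_index[OF assms, of "u - 1"]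
    by (auto simp del: index_minus_vec split: if_splits)
qed (auto simp: basis_vec_def)

section \<open>Cycles and flows in multigraphs\<close>

text \<open>The signed incidence matrix: a weight \<open>a\<close> on the edges is a flow when the
  terms \<open>a e * incidence G e v\<close> sum to zero at every vertex \<open>v\<close>. A loop
  has incidence 0 everywhere.\<close>

definition incidence :: "('v, 'e) pre_digraph \<Rightarrow> 'e \<Rightarrow> 'v \<Rightarrow> rat" where
  "incidence G e v = of_bool (tail G e = v) - of_bool (head G e = v)"

text \<open>The cyclic shift of positions along a cycle; reindexing by it cancels the vertices
  entered against the vertices left.\<close>

lemma bij_betw_Suc_mod: "bij_betw (\<lambda>i. Suc i mod n) {..<n} {..<n}"
proof -
  have "inj_on (\<lambda>i. Suc i mod n) {..<n}"
    by (rule inj_onI) (auto simp: mod_Suc split: if_splits)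
  moreover have "(\<lambda>i. Suc i mod n) ` {..<n} \<subseteq> {..<n}"
    by auto
  ultimately show ?thesis
    by (simp add: bij_betw_def endo_inj_surj)
qed

text \<open>The sign corrects the orientation, so that an edge traversed from \<open>u\<close> to
  \<open>w\<close> acts as if directed that way.\<close>

lemma joins_incidence:
  assumes "joins G e u w"
  shows "(if tail G e = u \<and> head G e = w then 1 else - 1) * incidence G e v
    = of_bool (u = v) - of_bool (w = v)"
  using assms by (auto simp: joins_def incidence_def)

text \<open>The weight is 1 on edges traversed along their orientation and -1 on those traversed
  against it; a cycle enters each vertex as often as it leaves it.\<close>

lemma undirected_cycle_flow:
  assumes "undirected_cycle G es"
  obtains a :: "'e \<Rightarrow> rat" where
    "\<And>e. e \<in> set es \<Longrightarrow> a e \<noteq> 0" "\<And>e. e \<notin> set es \<Longrightarrow> a e = 0"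
    "\<And>v. (\<Sum>e\<in>set es. a e * incidence G e v) = 0"
proof -
  from assms obtain vs where dist: "distinct es"
    and len: "length vs = length es"
    and join: "\<And>i. i < length es \<Longrightarrow> joins G (es ! i) (vs ! i) (vs ! (Suc i mod length es))"
    unfolding undirected_cycle_def by blast
  define n where "n = length es"
  have bij: "bij_betw ((!) es) {..<n} (set es)"
    using dist by (intro bij_betw_nth) (auto simp: n_def)
  define s where "s i = (if tail G (es ! i) = vs ! i \<and> head G (es ! i) = vs ! (Suc i mod n)
                         then 1 else - 1 :: rat)" for i
  \<comment> \<open>The edges of a cycle are distinct, so each has exactly one position, which
    supplies its sign.\<close>
  define a where "a e = (if e \<in> set es then s (the_inv_into {..<n} ((!) es) e) else 0)" for e
  have a_nth: "a (es ! i) = s i" if "i < n" for i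
    using that bij by (simp add: a_def n_def bij_betw_def the_inv_into_f_f)
  show ?thesis
  proof (rule that[of a])
    show "a e \<noteq> 0" if "e \<in> set es" for e
      using that by (simp add: a_def s_def)
    show "a e = 0" if "e \<notin> set es" for e
      using that by (simp add: a_def)
    fix v
    have "(\<Sum>e\<in>set es. a e * incidence G e v) = (\<Sum>i<n. a (es ! i) * incidence G (es ! i) v)"
      by (rule sum.reindex_bij_betw[OF bij, symmetric])
    also have "\<dots> = (\<Sum>i<n. of_bool (vs ! i = v) - of_bool (vs ! (Suc i mod n) = v))"
    proof (rule sum.cong)
      fix i assume "i \<in> {..<n}"
      then show "a (es ! i) * incidence G (es ! i) v
          = of_bool (vs ! i = v) - of_bool (vs ! (Suc i mod n) = v)"
        using joins_incidence[OF join[of i], of v] a_nth[of i] by (simp add: s_def n_def)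
    qed simp
    also have "\<dots> = 0"
      using sum.reindex_bij_betw[OF bij_betw_Suc_mod, of "\<lambda>i. of_bool (vs ! i = v) :: rat" n]
      by (simp add: sum_subtractf del: sum_of_bool_eq)
    finally show "(\<Sum>e\<in>set es. a e * incidence G e v) = 0" .
  qed
qed

text \<open>A walk that never immediately reuses an edge closes up at its first repeated vertex.\<close>

lemma non_backtracking_walk_cycle:
  fixes v :: "nat \<Rightarrow> 'v" and e :: "nat \<Rightarrow> 'e"
  assumes "finite U" "\<And>i. v i \<in> U"
    and arcs: "\<And>i. e i \<in> S" "S \<subseteq> arcs G"
    and join: "\<And>i. joins G (e i) (v i) (v (Suc i))"
    and turn: "\<And>i. e (Suc i) \<noteq> e i"
  obtains es where "undirected_cycle G es" "set es \<subseteq> S"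
proof -
  define rep where "rep j \<longleftrightarrow> (\<exists>i<j. v i = v j)" for j
  have "\<not> inj v"
    using assms(1,2) by (metis finite_imageD finite_subset image_subsetI infinite_UNIV_nat)
  then obtain i j where "i \<noteq> j" "v i = v j"
    by (auto simp: inj_def)
  then have "\<exists>j. rep j"
    unfolding rep_def by (metis linorder_neqE_nat)
  then have rep: "rep (LEAST j. rep j)"
    by (auto intro: LeastI)
  \<comment> \<open>\<open>j\<close> is the first time at which a vertex is revisited and
    \<open>i\<close> the earlier visit, so \<open>v\<close> is injective below \<open>j\<close> and
    the edges from \<open>i\<close> to \<open>j - 1\<close> are the candidate cycle.\<close>
  define j where "j = (LEAST j. rep j)"
  from rep obtain i where ij: "i < j" "v i = v j"
    by (auto simp: j_def rep_def)
  have inj: "inj_on v {..<j}"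
  proof (rule inj_onI)
    fix x y assume "x \<in> {..<j}" "y \<in> {..<j}" "v x = v y"
    moreover have "\<not> rep k" if "k < j" for k
      using that not_less_Least by (auto simp: j_def)
    ultimately show "x = y"
      unfolding rep_def by (metis lessThan_iff linorder_neqE_nat)
  qed
  have v_eq: "v x = v y \<longleftrightarrow> x = y" if "x < j" "y < j" for x y
    using inj that by (auto simp: inj_on_def)
  \<comment> \<open>An edge used at times \<open>x < y\<close> has the same two ends both times.
    Injectivity rules out the same direction, and the opposite direction forces
    \<open>y = Suc x\<close>, an immediate reuse.\<close>
  have e_eq: "x = y" if eq: "e x = e y" "x < y" "y < j" "i \<le> x" for x y
  proof -
    have "(v x = v y \<and> v (Suc x) = v (Suc y)) \<or> (v x = v (Suc y) \<and> v (Suc x) = v y)"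
      using join[of x] join[of y] eq(1) by (auto simp: joins_def)
    then have "v (Suc x) = v y"
      using v_eq[of x y] eq by auto
    then have "y = Suc x"
      using v_eq[of "Suc x" y] eq by auto
    then show ?thesis
      using turn[of x] eq by simp
  qed
  define es where "es = map e [i..<j]"
  define vs where "vs = map v [i..<j]"
  have "undirected_cycle G es"
    unfolding undirected_cycle_def
  proof (intro conjI exI[of _ vs])
    show "es \<noteq> []" "length vs = length es" "set es \<subseteq> arcs G"
      using ij arcs by (auto simp: es_def vs_def)
    show "distinct es"
      unfolding es_def distinct_map
      by (auto intro!: inj_onI) (metis e_eq linorder_neqE_nat)
    show "distinct vs"
      using v_eq by (auto simp: vs_def distinct_map inj_on_def)
    show "\<forall>k<length es. joins G (es ! k) (vs ! k) (vs ! (Suc k mod length es))"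
    proof (intro allI impI)
      fix k assume k: "k < length es"
      \<comment> \<open>At the last position the index wraps around to 0, and
        \<open>v j = v i\<close> closes the cycle.\<close>
      then have "v (Suc (i + k)) = vs ! (Suc k mod length es)"
        using ij by (auto simp: es_def vs_def mod_Suc)
          (metis add.commute add_Suc le_add_diff_inverse less_or_eq_imp_le)
      then show "joins G (es ! k) (vs ! k) (vs ! (Suc k mod length es))"
        using k join[of "i + k"] by (simp add: es_def vs_def)
    qed
  qed
  moreover have "set es \<subseteq> S"
    using arcs by (auto simp: es_def)
  ultimately show ?thesis by (rule that)
qed

text \<open>Loops are treated first, as cycles of length 1: their incidence vanishes, so
  conservation at their ends would not yield a further edge.\<close>

lemma flow_undirected_cycle:
  fixes a :: "'e \<Rightarrow> rat"
  assumes "finite S" "S \<subseteq> arcs G"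
    and flow: "\<And>v. (\<Sum>e\<in>S. a e * incidence G e v) = 0"
    and e0: "e0 \<in> S" "a e0 \<noteq> 0"
  obtains es where "undirected_cycle G es" "set es \<subseteq> S"
proof (cases "\<exists>e\<in>S. tail G e = head G e")
  case True
  then obtain e where "e \<in> S" "tail G e = head G e" by blast
  then have "undirected_cycle G [e]"
    using assms(2) by (auto simp: undirected_cycle_def joins_def intro: exI[of _ "[head G e]"])
  then show ?thesis using that \<open>e \<in> S\<close> by force
next
  case False
  define T where "T = {e \<in> S. a e \<noteq> 0}"
  \<comment> \<open>The flag \<open>snd s\<close> is true when the edge is traversed from tail to
    head; negating it turns the exit vertex into the entry vertex.\<close>
  define exit_of where "exit_of s = (if snd s then head G (fst s) else tail G (fst s))" for s :: "'e \<times> bool"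
  \<comment> \<open>If \<open>e\<close> were the only edge of the support at \<open>w\<close>, the
    balance at \<open>w\<close> would reduce to a single term, nonzero because \<open>e\<close> is
    not a loop.\<close>
  have step: "\<exists>e'\<in>T. e' \<noteq> e \<and> w \<in> {tail G e', head G e'}"
    if "e \<in> T" "w \<in> {tail G e, head G e}" for e w
  proof (rule ccontr)
    assume *: "\<not> ?thesis"
    have "(\<Sum>e'\<in>S. a e' * incidence G e' w) = a e * incidence G e w"
    proof (rule sum.remove[OF \<open>finite S\<close>, of e, THEN trans])
      show "e \<in> S" using that by (simp add: T_def)
      have "(\<Sum>e'\<in>S - {e}. a e' * incidence G e' w) = 0"
        using * by (intro sum.neutral) (auto simp: T_def incidence_def)
      then show "a e * incidence G e w + (\<Sum>e'\<in>S - {e}. a e' * incidence G e' w)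
          = a e * incidence G e w" by simp
    qed
    moreover have "incidence G e w \<noteq> 0" "a e \<noteq> 0"
      using that False by (auto simp: T_def incidence_def)
    ultimately show False using flow[of w] by simp
  qed
  text \<open>A state is an edge with the direction in which it is traversed.\<close>
  define ok where "ok s s' \<longleftrightarrow> fst s' \<noteq> fst s \<and> exit_of s = exit_of (fst s', \<not> snd s')"
    for s s' :: "'e \<times> bool"
  have "\<exists>f. \<forall>k. fst (f k) \<in> T \<and> ok (f k) (f (Suc k))"
  proof (rule dependent_nat_choice)
    show "\<exists>s. fst s \<in> T" using e0 by (auto simp: T_def)
    fix s :: "'e \<times> bool" and k :: nat
    assume "fst s \<in> T"
    moreover have "exit_of s \<in> {tail G (fst s), head G (fst s)}"
      by (simp add: exit_of_def)
    ultimately obtain e' where e': "e' \<in> T" "e' \<noteq> fst s" "exit_of s \<in> {tail G e', head G e'}"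
      using step by blast
    \<comment> \<open>The next edge is traversed from tail to head exactly when the current exit is
      its tail.\<close>
    then show "\<exists>s'. fst s' \<in> T \<and> ok s s'"
      by (intro exI[of _ "(e', exit_of s = tail G e')"]) (auto simp: ok_def exit_of_def)
  qed
  then obtain f where f: "\<And>k. fst (f k) \<in> T" "\<And>k. ok (f k) (f (Suc k))" by blast
  \<comment> \<open>The walk visits the entry vertices; the exit of one state is the entry of the
    next.\<close>
  define v where "v k = exit_of (fst (f k), \<not> snd (f k))" for k
  have v_Suc: "v (Suc k) = exit_of (f k)" for k
    using f(2)[of k] by (simp add: ok_def v_def)
  show ?thesis
  proof (rule non_backtracking_walk_cycle[where v = v and e = "\<lambda>k. fst (f k)"])
    show "finite (tail G ` S \<union> head G ` S)" using \<open>finite S\<close> by simp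
    show "v k \<in> tail G ` S \<union> head G ` S" for k
      using f(1)[of k] by (auto simp: v_def exit_of_def T_def)
    show "fst (f k) \<in> S" for k using f(1)[of k] by (simp add: T_def)
    show "S \<subseteq> arcs G" by fact
    show "joins G (fst (f k)) (v k) (v (Suc k))" for k
      unfolding v_Suc by (auto simp: joins_def v_def exit_of_def)
    show "fst (f (Suc k)) \<noteq> fst (f k)" for k
      using f(2)[of k] by (simp add: ok_def)
  qed (rule that)
qed

section \<open>The column matroid of a network matrix\<close>

text \<open>\<open>bdry\<close> is an invertible integer linear map: differences of rows turn
  relations among the columns into relations among their images, and partial sums turn them
  back.\<close>

lemma column_relation_iff_bdry:
  fixes a :: "nat \<Rightarrow> rat"
  assumes "S \<subseteq> {..<dim_col B}"
  shows "(\<forall>i<dim_row B. (\<Sum>j\<in>S. a j * of_int (B $$ (i, j))) = 0) \<longleftrightarrow>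
     (\<forall>k\<le>dim_row B. (\<Sum>j\<in>S. a j * of_int (bdry (col B j) $ k)) = 0)" (is "?L \<longleftrightarrow> ?R")
proof
  assume L: ?L
  show ?R
  proof (intro allI impI)
    fix k assume k: "k \<le> dim_row B"
    \<comment> \<open>The conditionals stand for zero rows before the first and after the last, so
      the sum is a difference of two row relations.\<close>
    have "(\<Sum>j\<in>S. a j * of_int (bdry (col B j) $ k)) =
        (\<Sum>j\<in>S. (if k < dim_row B then a j * of_int (B $$ (k, j)) else 0)
             - (if k = 0 then 0 else a j * of_int (B $$ (k - 1, j))))"
      using k assms by (intro sum.cong) (auto simp: bdry_index right_diff_distrib subset_iff)
    also have "\<dots> = 0"
      using L k by (cases "k = 0"; cases "k < dim_row B") (auto simp: sum_subtractf sum_negf)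
    finally show "(\<Sum>j\<in>S. a j * of_int (bdry (col B j) $ k)) = 0" .
  qed
next
  assume R: ?R
  show ?L
  proof (intro allI impI)
    fix i assume i: "i < dim_row B"
    have "(\<Sum>j\<in>S. a j * of_int (B $$ (i, j)))
        = (\<Sum>j\<in>S. \<Sum>k\<le>i. a j * of_int (bdry (col B j) $ k))"
    proof (rule sum.cong)
      fix j assume "j \<in> S"
      then have "B $$ (i, j) = (\<Sum>k\<le>i. bdry (col B j) $ k)"
        using i assms by (subst partial_sum_bdry) auto
      then show "a j * of_int (B $$ (i, j)) = (\<Sum>k\<le>i. a j * of_int (bdry (col B j) $ k))"
        by (simp add: sum_distrib_left)
    qed simp
    also have "\<dots> = (\<Sum>k\<le>i. \<Sum>j\<in>S. a j * of_int (bdry (col B j) $ k))"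
      by (rule sum.swap)
    also have "\<dots> = 0"
      using R i by simp
    finally show "(\<Sum>j\<in>S. a j * of_int (B $$ (i, j))) = 0" .
  qed
qed

section \<open>Column relations as flows on a column graph\<close>

lemma column_graph_ends:
  assumes "is_column_graph B G" "j < dim_col B"
  shows "tail G j \<in> {1..dim_row B + 1}" "head G j \<in> {1..dim_row B + 1}"
proof -
  from assms have "wf_digraph G" "verts G = {1..dim_row B + 1}" "j \<in> arcs G"
    by (auto simp: is_column_graph_def)
  then show "tail G j \<in> {1..dim_row B + 1}" "head G j \<in> {1..dim_row B + 1}"
    using wf_digraph.tail_in_verts wf_digraph.head_in_verts by metis+
qed

text \<open>Coordinate \<open>k\<close> of the image of a column is the incidence at vertex
  \<open>Suc k\<close>, since vertices are counted from 1 and positions from 0.\<close>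

lemma column_relation_iff_flow:
  fixes a :: "nat \<Rightarrow> rat"
  assumes G: "is_column_graph B G" and S: "S \<subseteq> {..<dim_col B}"
  shows "(\<forall>i<dim_row B. (\<Sum>j\<in>S. a j * of_int (B $$ (i, j))) = 0) \<longleftrightarrow>
     (\<forall>v. (\<Sum>j\<in>S. a j * incidence G j v) = 0)"
proof -
  have inc: "of_int (bdry (col B j) $ k) = incidence G j (Suc k)"
    if "j \<in> S" "k \<le> dim_row B" for j k
  proof -
    have "j < dim_col B" using that S by auto
    then have "bdry (col B j) = basis_vec (dim_row B + 1) (tail G j) - basis_vec (dim_row B + 1) (head G j)"
      using G by (simp add: is_column_graph_def)
    then show ?thesis
      using basis_vec_diff_index[OF column_graph_ends[OF G \<open>j < dim_col B\<close>], of k] that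
      by (simp add: incidence_def)
  qed
  have "(\<forall>k\<le>dim_row B. (\<Sum>j\<in>S. a j * of_int (bdry (col B j) $ k)) = 0) \<longleftrightarrow>
      (\<forall>k\<le>dim_row B. (\<Sum>j\<in>S. a j * incidence G j (Suc k)) = 0)"
    using inc by (simp cong: sum.cong)
  also have "\<dots> \<longleftrightarrow> (\<forall>v. (\<Sum>j\<in>S. a j * incidence G j v) = 0)"
  proof (intro iffI allI)
    fix v
    assume *: "\<forall>k\<le>dim_row B. (\<Sum>j\<in>S. a j * incidence G j (Suc k)) = 0"
    show "(\<Sum>j\<in>S. a j * incidence G j v) = 0"
    proof (cases "v \<in> {1..dim_row B + 1}")
      case True
      then show ?thesis using *[rule_format, of "v - 1"] by auto
    next
      case False
      \<comment> \<open>A number outside the vertex range is an end of no edge, so conservation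
        there is trivial.\<close>
      then have "incidence G j v = 0" if "j \<in> S" for j
        using column_graph_ends[OF G, of j] that S by (auto simp: incidence_def)
      then show ?thesis by simp
    qed
  qed simp
  finally show ?thesis
    using column_relation_iff_bdry[OF S] by simp
qed

lemma independent_columns_iff_acyclic:
  assumes G: "is_column_graph B G" and S: "S \<subseteq> {..<dim_col B}"
  shows "independent_columns B S \<longleftrightarrow> (\<nexists>es. undirected_cycle G es \<and> set es \<subseteq> S)"
proof
  assume ind: "independent_columns B S"
  show "\<nexists>es. undirected_cycle G es \<and> set es \<subseteq> S"
  proof clarify
    fix es assume es: "undirected_cycle G es" "set es \<subseteq> S"
    obtain a :: "nat \<Rightarrow> rat" where a: "\<And>e. e \<in> set es \<Longrightarrow> a e \<noteq> 0" "\<And>e. e \<notin> set es \<Longrightarrow> a e = 0"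
      and flow: "\<And>v. (\<Sum>e\<in>set es. a e * incidence G e v) = 0"
      using undirected_cycle_flow[OF es(1)] by blast
    have "finite S" using S finite_subset by blast
    \<comment> \<open>The flow of the cycle vanishes outside \<open>set es\<close>, so it extends to
      a flow on \<open>S\<close>.\<close>
    then have "(\<Sum>e\<in>S. a e * incidence G e v) = 0" for v
      using sum.mono_neutral_right[OF _ es(2), of "\<lambda>e. a e * incidence G e v"] flow[of v] a(2)
      by simp
    then have "\<forall>j\<in>S. a j = 0"
      using ind column_relation_iff_flow[OF G S, of a] by (simp add: independent_columns_def)
    moreover obtain e where "e \<in> set es"
      using es(1) by (cases es) (auto simp: undirected_cycle_def)
    ultimately show False using a(1) es(2) by blast
  qed
next
  assume acyclic: "\<nexists>es. undirected_cycle G es \<and> set es \<subseteq> S"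
  show "independent_columns B S"
    unfolding independent_columns_def
  proof (intro allI impI ballI, rule ccontr)
    fix a :: "nat \<Rightarrow> rat" and j
    assume "\<forall>i<dim_row B. (\<Sum>j\<in>S. a j * of_int (B $$ (i, j))) = 0" "j \<in> S" "a j \<noteq> 0"
    moreover have "finite S" "S \<subseteq> arcs G"
      using G S finite_subset by (auto simp: is_column_graph_def)
    ultimately obtain es where "undirected_cycle G es" "set es \<subseteq> S"
      using column_relation_iff_flow[OF G S, of a] flow_undirected_cycle[of S G a j] by metis
    then show False using acyclic by blast
  qed
qed

lemma column_matroid_eq_cycle_matroid:
  assumes "is_column_graph B G"
  shows "column_matroid B = cycle_matroid G"
  using assms independent_columns_iff_acyclic[OF assms]
  by (auto simp: column_matroid_def cycle_matroid_def is_column_graph_def)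

lemma independent_columns_iff_forest:
  assumes "is_column_graph B G"
  shows "independent_columns B {..<dim_col B} \<longleftrightarrow> undirected_forest G"
proof -
  have "set es \<subseteq> {..<dim_col B}" if "undirected_cycle G es" for es
    using that assms by (auto simp: undirected_cycle_def is_column_graph_def)
  then show ?thesis
    using independent_columns_iff_acyclic[OF assms subset_refl] by (auto simp: undirected_forest_def)
qed

section \<open>Folding\<close>

text \<open>The description by \<open>THE\<close> needs existence and uniqueness. For existence take
  the residue or, if it exceeds \<open>m\<close>, its distance to the modulus. For uniqueness,
  \<open>c - d\<close> and \<open>c + d\<close> are both smaller than the modulus in absolute value,
  so one of them is zero.\<close>

lemma folded_class_spec:
  shows folded_class_le: "folded_class m a \<le> m"
    and folded_class_cong:
      "[a = int (folded_class m a)] (mod modulus m) \<or> [a = - int (folded_class m a)] (mod modulus m)"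
proof -
  let ?P = "\<lambda>c. c \<le> m \<and> ([a = int c] (mod modulus m) \<or> [a = - int c] (mod modulus m))"
  define s where "s = a mod modulus m"
  have s: "0 \<le> s" "s < 2 * int m + 1" "[a = s] (mod modulus m)"
    using pos_mod_bound[of "modulus m" a] by (simp_all add: s_def modulus_def cong_def)
  have "\<exists>c. ?P c"
  proof (cases "s \<le> int m")
    case True
    then show ?thesis using s by (intro exI[of _ "nat s"]) auto
  next
    case False
    have "[s = s - modulus m] (mod modulus m)" by (simp add: cong_def)
    then have "[a = s - modulus m] (mod modulus m)" using s(3) cong_trans by blast
    then show ?thesis using False s by (intro exI[of _ "nat (modulus m - s)"]) (auto simp: modulus_def)
  qed
  moreover have "c = d" if "?P c" "?P d" for c d
  proof -
    have "[int c = int d] (mod modulus m) \<or> [int c = - int d] (mod modulus m)"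
      using that by (auto simp: cong_def) (metis minus_minus mod_minus_cong)+
    then have "modulus m dvd int c - int d \<or> modulus m dvd int c + int d"
      by (auto simp: cong_iff_dvd_diff)
    moreover have "\<bar>int c - int d\<bar> < modulus m" "\<bar>int c + int d\<bar> < modulus m"
      using that by (auto simp: modulus_def)
    ultimately have "int c - int d = 0 \<or> int c + int d = 0"
      using dvd_imp_le_int[of "int c - int d" "modulus m"]
        dvd_imp_le_int[of "int c + int d" "modulus m"] by (smt (verit))
    then show ?thesis by auto
  qed
  ultimately have "\<exists>!c. ?P c" by blast
  from theI'[OF this] show "folded_class m a \<le> m"
    "[a = int (folded_class m a)] (mod modulus m) \<or> [a = - int (folded_class m a)] (mod modulus m)"
    by (auto simp: folded_class_def)
qed

lemma folding_sign_cases: "folding_sign m a = 1 \<or> folding_sign m a = - 1"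
  by (simp add: folding_sign_def)

lemma folding_sign_class_0: "folded_class m a = 0 \<Longrightarrow> folding_sign m a = 1"
  using folded_class_cong[of a m] by (simp add: folding_sign_def)

lemma folding_dvd: "modulus m dvd a - folding_sign m a * int (folded_class m a)"
  using folded_class_cong[of a m] by (auto simp: folding_sign_def cong_iff_dvd_diff)

section \<open>Columns of a block\<close>

text \<open>With \<open>v\<close> and the modulus odd, the quotient of \<open>v - x\<close> by the
  modulus is odd exactly when \<open>x\<close> is even, and at least 1 exactly when
  \<open>v > x\<close>.\<close>

lemma odd_multiple_iff:
  assumes "odd v"
  shows "(\<exists>k::int. odd k \<and> k \<ge> 1 \<and> v = x + modulus m * k) \<longleftrightarrow>
     even x \<and> v > x \<and> modulus m dvd v - x"
proof
  assume "\<exists>k::int. odd k \<and> k \<ge> 1 \<and> v = x + modulus m * k"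
  then obtain k where "odd k" "k \<ge> 1" "v = x + modulus m * k" by blast
  moreover from this have "modulus m * k > 0" by (simp add: modulus_def)
  ultimately show "even x \<and> v > x \<and> modulus m dvd v - x"
    using assms by (auto simp: modulus_def)
next
  assume *: "even x \<and> v > x \<and> modulus m dvd v - x"
  then obtain k where k: "v - x = modulus m * k" by (auto elim: dvdE)
  then have "odd (modulus m * k)" "modulus m * k > 0" using * assms by (auto simp flip: k)
  then have "odd k" "k \<ge> 1" by (auto simp: modulus_def zero_less_mult_iff)
  then show "\<exists>k::int. odd k \<and> k \<ge> 1 \<and> v = x + modulus m * k"
    using k by (intro exI[of _ k]) auto
qed

text \<open>Both \<open>V\<close> and its negative are odd, so the parity and threshold criterion
  applies to each sign separately.\<close>

lemma free_entry_eq: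
  "free_entry m r \<Lambda> X i j =
     of_bool (even (X j) \<and> V m r \<Lambda> i > X j \<and> modulus m dvd V m r \<Lambda> i - X j)
     - of_bool (even (X j) \<and> - V m r \<Lambda> i > X j \<and> modulus m dvd - V m r \<Lambda> i - X j)"
proof -
  define P where "P \<epsilon> \<longleftrightarrow> even (X j) \<and> \<epsilon> * V m r \<Lambda> i > X j \<and> modulus m dvd \<epsilon> * V m r \<Lambda> i - X j"
    for \<epsilon>
  have "odd (V m r \<Lambda> i)" by (simp add: V_def)
  then have "{\<epsilon>. \<epsilon> \<in> {1, - 1} \<and> (\<exists>k::int. odd k \<and> k \<ge> 1 \<and> \<epsilon> * V m r \<Lambda> i = X j + modulus m * k)}
      = {\<epsilon> \<in> {1, - 1}. P \<epsilon>}"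
    unfolding P_def by (intro Collect_cong conj_cong refl odd_multiple_iff) auto
  moreover have "(\<Sum>\<epsilon> | \<epsilon> \<in> {1, - 1} \<and> P \<epsilon>. \<epsilon>) = (\<Sum>\<epsilon>\<in>{1, - 1}. if P \<epsilon> then \<epsilon> else 0)"
    by (rule sum.inter_filter) simp
  ultimately show ?thesis
    by (simp add: free_entry_def P_def)
qed

text \<open>Up to multiples of the modulus, \<open>v - x\<close> is \<open>(s - s') * c\<close>,
  which is 0 or, up to sign, \<open>2 * c\<close>; the latter lies strictly between 0 and the
  modulus.\<close>

lemma modulus_dvd_signed_diff_iff:
  assumes "1 \<le> c" "c \<le> m" "s \<in> {1, - 1}" "s' \<in> {1, - 1}"
    and "modulus m dvd v - s * int c" "modulus m dvd x - s' * int c"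
  shows "modulus m dvd v - x \<longleftrightarrow> s = s'"
proof -
  have "v - x = (s * int c - s' * int c) + ((v - s * int c) - (x - s' * int c))"
    by simp
  then have *: "modulus m dvd v - x \<longleftrightarrow> modulus m dvd s * int c - s' * int c"
    using assms(5,6) by (metis dvd_add_left_iff dvd_diff)
  have "\<not> modulus m dvd 2 * int c"
    using assms(1,2) by (intro zdvd_not_zless) (auto simp: modulus_def)
  then have "\<not> modulus m dvd - (2 * int c)"
    by simp
  with \<open>\<not> modulus m dvd 2 * int c\<close> show ?thesis
    unfolding * using assms(3,4) by auto
qed

text \<open>Within one class the congruences are decided by the class and the signs, so only a
  comparison with \<open>X j\<close> is left. A monotone \<open>P\<close> of either direction covers
  all classes uniformly.\<close>

lemma free_entry_threshold:
  assumes pos: "\<And>i. i \<in> I \<Longrightarrow> V m r \<Lambda> i > 0"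
    and row: "\<And>i. i \<in> I \<Longrightarrow> row_class m r \<Lambda> i = folded_class m (X j)"
  obtains P :: "int \<Rightarrow> bool" where
    "(\<forall>x y. x \<le> y \<longrightarrow> P x \<longrightarrow> P y) \<or> (\<forall>x y. x \<le> y \<longrightarrow> P y \<longrightarrow> P x)"
    "\<And>i. i \<in> I \<Longrightarrow> row_sign m r \<Lambda> i * folding_sign m (X j) * free_entry m r \<Lambda> X i j
        = of_bool (P (row_weight m r \<Lambda> i))"
proof (cases "folded_class m (X j) = 0")
  case True
  \<comment> \<open>In class 0 both signs can contribute to an entry; they cancel in the rows with \<open>V \<le> - X j\<close>.\<close>
  have "odd (V m r \<Lambda> i)" for i by (simp add: V_def)
  have entry: "row_sign m r \<Lambda> i * folding_sign m (X j) * free_entry m r \<Lambda> X i j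
      = of_bool (even (X j) \<and> row_weight m r \<Lambda> i > \<bar>X j\<bar>)" if "i \<in> I" for i
  proof -
    have sign: "row_sign m r \<Lambda> i = 1" "folding_sign m (X j) = 1"
      using True row[OF that] by (simp_all add: row_sign_def row_class_def folding_sign_class_0)
    have "modulus m dvd V m r \<Lambda> i" "modulus m dvd X j"
      using folding_dvd[of m "V m r \<Lambda> i"] folding_dvd[of m "X j"] True row[OF that]
      by (simp_all add: row_class_def)
    then have "modulus m dvd V m r \<Lambda> i - X j" "modulus m dvd - V m r \<Lambda> i - X j"
      by (auto intro: dvd_diff)
    \<comment> \<open>Parity excludes equality, which makes the bound by
      \<open>\<bar>X j\<bar>\<close> strict also for negative \<open>X j\<close>.\<close>
    moreover have "V m r \<Lambda> i \<noteq> - X j" if "even (X j)"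
      using that \<open>odd (V m r \<Lambda> i)\<close> by auto
    ultimately show ?thesis
      using pos[OF that] by (auto simp: sign row_weight_def free_entry_eq)
  qed
  show ?thesis
    by (rule that[of "\<lambda>w. even (X j) \<and> w > \<bar>X j\<bar>"]) (auto simp: entry)
next
  case False
  define s where "s = folding_sign m (X j)"
  have entry: "row_sign m r \<Lambda> i * folding_sign m (X j) * free_entry m r \<Lambda> X i j
      = of_bool (even (X j) \<and> s * row_weight m r \<Lambda> i > X j)" if "i \<in> I" for i
  proof -
    let ?c = "folded_class m (X j)" and ?v = "V m r \<Lambda> i" and ?\<sigma> = "row_sign m r \<Lambda> i"
    have c: "1 \<le> ?c" "?c \<le> m" using False folded_class_le by auto
    have signs: "s \<in> {1, - 1}" "?\<sigma> \<in> {1, - 1}" "- ?\<sigma> \<in> {1, - 1}"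
      using folding_sign_cases[of m] by (auto simp: s_def row_sign_def)
    have X: "modulus m dvd X j - s * int ?c"
      using folding_dvd by (simp add: s_def)
    have v: "modulus m dvd ?v - ?\<sigma> * int ?c"
      using folding_dvd[of m ?v] row[OF that] by (simp add: row_sign_def row_class_def)
    then have "modulus m dvd - (?v - ?\<sigma> * int ?c)"
      by (simp only: dvd_minus_iff)
    then have v': "modulus m dvd - ?v - (- ?\<sigma>) * int ?c"
      by simp
    \<comment> \<open>Exactly one of \<open>V\<close> and \<open>- V\<close> is congruent to
      \<open>X j\<close>, namely the one equal to \<open>s * row_weight m r \<Lambda> i\<close>; the
      two signs in the product make its contribution nonnegative.\<close>
    have "modulus m dvd ?v - X j \<longleftrightarrow> ?\<sigma> = s" "modulus m dvd - ?v - X j \<longleftrightarrow> - ?\<sigma> = s"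
      using modulus_dvd_signed_diff_iff[OF c signs(2,1) v X]
        modulus_dvd_signed_diff_iff[OF c signs(3,1) v' X] by auto
    then show ?thesis
      using signs by (auto simp: free_entry_eq row_weight_def simp flip: s_def)
  qed
  have "s = 1 \<or> s = - 1" using folding_sign_cases by (simp add: s_def)
  then show ?thesis
    by (intro that[of "\<lambda>w. even (X j) \<and> s * w > X j"]) (auto simp: entry)
qed

text \<open>An upward closed predicate is cut off by its least true position, a downward closed one
  by its least false position, if there is one.\<close>

lemma monotone_indicator_interval:
  fixes Q :: "nat \<Rightarrow> bool"
  assumes x: "x \<in> carrier_vec n" "\<And>a. a < n \<Longrightarrow> x $ a = of_bool (Q a)"
    and mono: "(\<forall>a b. a \<le> b \<and> b < n \<longrightarrow> Q a \<longrightarrow> Q b) \<or> (\<forall>a b. a \<le> b \<and> b < n \<longrightarrow> Q b \<longrightarrow> Q a)"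
    and "x \<noteq> 0\<^sub>v n"
  shows "(\<exists>k. 1 \<le> k \<and> k < n \<and> x = interval_vec n 1 k) \<or>
    (\<exists>k. 1 \<le> k \<and> k < n \<and> x = interval_vec n (k + 1) n) \<or> x = interval_vec n 1 n"
proof -
  have "\<exists>a<n. Q a"
  proof (rule ccontr)
    assume "\<not> (\<exists>a<n. Q a)"
    then have "x = 0\<^sub>v n" using x by (intro eq_vecI) auto
    then show False using \<open>x \<noteq> 0\<^sub>v n\<close> by simp
  qed
  then obtain a where a: "a < n" "Q a" by blast
  have x_eq: "x = interval_vec n p q" if "\<And>a. a < n \<Longrightarrow> Q a \<longleftrightarrow> p \<le> Suc a \<and> Suc a \<le> q" for p q
    using x that by (intro eq_vecI) (auto simp: interval_vec_def)
  from mono show ?thesis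
  proof
    assume up: "\<forall>a b. a \<le> b \<and> b < n \<longrightarrow> Q a \<longrightarrow> Q b"
    \<comment> \<open>Position \<open>k\<close> holds row \<open>k + 1\<close>, so the suffix starts
      at \<open>k + 1\<close> and is the full interval for \<open>k = 0\<close>.\<close>
    define k where "k = (LEAST a. Q a)"
    have "Q k" "k \<le> a" using a by (auto simp: k_def intro: LeastI Least_le)
    have "Q b \<longleftrightarrow> k \<le> b" if "b < n" for b
      using that up \<open>Q k\<close> by (auto simp: k_def intro: Least_le)
    then have "x = interval_vec n (k + 1) n"
      by (intro x_eq) auto
    moreover have "k < n" using \<open>k \<le> a\<close> a by simp
    ultimately show ?thesis by (cases "k = 0") (auto simp: Suc_le_eq)
  next
    assume down: "\<forall>a b. a \<le> b \<and> b < n \<longrightarrow> Q b \<longrightarrow> Q a"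
    show ?thesis
    proof (cases "\<exists>b<n. \<not> Q b")
      case True
      define k where "k = (LEAST b. \<not> Q b)"
      have "\<not> Q k" "k < n"
        using True LeastI_ex[of "\<lambda>b. \<not> Q b"] by (auto simp: k_def intro: le_less_trans[OF Least_le])
      have "Q b \<longleftrightarrow> b < k" if "b < n" for b
        using that down \<open>\<not> Q k\<close> not_less_Least[of b "\<lambda>b. \<not> Q b"]
        by (metis k_def linorder_not_less)
      then have "x = interval_vec n 1 k" "0 < k"
        using a down \<open>\<not> Q k\<close> by (auto intro!: x_eq)
      then show ?thesis using \<open>k < n\<close> by (intro disjI1 exI[of _ k]) auto
    next
      case False
      then have "x = interval_vec n 1 n" by (intro x_eq) auto
      then show ?thesis by simp
    qed
  qed
qed

text \<open>An entry depends on its row through a monotone predicate of the weight, and the sorted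
  row order makes the weights weakly increase down the block.\<close>

lemma interval_block_col:
  assumes nonneg: "\<And>i. 1 \<le> i \<Longrightarrow> i \<le> m + r \<Longrightarrow> 0 \<le> \<Lambda> i"
    and B: "B = interval_block m r \<Lambda> X c" and n: "n = dim_row B"
    and j: "j < dim_col B" "col B j \<noteq> 0\<^sub>v n"
  shows "(\<exists>k. 1 \<le> k \<and> k < n \<and> col B j = interval_vec n 1 k) \<or>
    (\<exists>k. 1 \<le> k \<and> k < n \<and> col B j = interval_vec n (k + 1) n) \<or> col B j = interval_vec n 1 n"
proof -
  let ?A = "interval_form m r \<Lambda> X"
  define I where "I = {a. a < m + r \<and> row_class m r \<Lambda> (row_order m r \<Lambda> ! a) = c}"
  define J where "J = {b. b < m + r \<and> col_class m X (Suc b) = c}"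
  have B_sub: "B = submatrix ?A I J" by (simp add: B I_def J_def interval_block_def)
  have rows: "{i. i < dim_row ?A \<and> i \<in> I} = I" and cols: "{i. i < dim_col ?A \<and> i \<in> J} = J"
    by (auto simp: interval_form_def I_def J_def)
  have n_card: "n = card I" and j_card: "j < card J"
    using j(1) by (simp_all add: n B_sub dim_submatrix rows cols)
  define b where "b = pick J j"
  have b: "b < m + r" "col_class m X (Suc b) = c"
    using pick_in_set_le[OF j_card] by (auto simp: b_def J_def)
  \<comment> \<open>\<open>row a\<close> is the number in the original matrix, counted from 1, of
    the row at position \<open>a\<close> of the block.\<close>
  define row where "row a = row_order m r \<Lambda> ! pick I a" for a
  have pick: "pick I a < m + r" "row_class m r \<Lambda> (row a) = c" if "a < n" for a
    using pick_in_set_le[of a I] that n_card by (auto simp: I_def row_def)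
  have len: "length (row_order m r \<Lambda>) = m + r" by (simp add: row_order_def del: upt_Suc)
  have row_range: "1 \<le> row a" "row a \<le> m + r" if "a < n" for a
  proof -
    have "set (row_order m r \<Lambda>) = {1..m + r}"
      by (simp only: row_order_def set_sort set_upt atLeastLessThanSuc_atLeastAtMost flip: Suc_eq_plus1)
    then show "1 \<le> row a" "row a \<le> m + r"
      using nth_mem[of "pick I a" "row_order m r \<Lambda>"] pick[OF that] len by (auto simp: row_def)
  qed
  have weight_mono: "row_weight m r \<Lambda> (row a) \<le> row_weight m r \<Lambda> (row a')"
    if "a \<le> a'" "a' < n" for a a'
  proof -
    let ?key = "\<lambda>i. (row_class m r \<Lambda> i, row_weight m r \<Lambda> i)"
    have "pick I a \<le> pick I a'"
      using that n_card pick_mono_le[of a' I a] by (cases "a = a'") auto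
    moreover have "sorted (map ?key (row_order m r \<Lambda>))"
      by (simp add: row_order_def)
    ultimately have "?key (row a) \<le> ?key (row a')"
      using sorted_nth_mono[of "map ?key (row_order m r \<Lambda>)" "pick I a" "pick I a'"]
        pick[of a] pick[of a'] that len by (simp add: row_def)
    \<comment> \<open>Both keys have class \<open>c\<close>, so the lexicographic order compares the
      weights.\<close>
    then show ?thesis using pick[of a] pick[of a'] that by (simp add: less_eq_prod_def)
  qed
  have entry: "col B j $ a = row_sign m r \<Lambda> (row a) * col_sign m X (Suc b)
      * big_matrix m r \<Lambda> X $$ (row a - 1, b)" if "a < n" for a
  proof -
    have "col B j $ a = ?A $$ (pick I a, b)"
      using that j(1) n n_card j_card submatrix_index[of a ?A I j J]
      by (simp add: rows cols b_def flip: B_sub)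
    then show ?thesis using pick[OF that] b by (simp add: interval_form_def row_def Let_def)
  qed
  have "\<exists>P. ((\<forall>x y. x \<le> y \<longrightarrow> P x \<longrightarrow> P y) \<or> (\<forall>x y. x \<le> y \<longrightarrow> P y \<longrightarrow> P x)) \<and>
      (\<forall>a<n. col B j $ a = of_bool (P (row_weight m r \<Lambda> (row a))))"
  proof (cases "Suc b \<le> m")
    case True
    have "col B j $ a = 1" if "a < n" for a
      using True b pick[OF that] row_range[OF that] folding_sign_cases[of m "V m r \<Lambda> (row a)"]
      by (auto simp: entry[OF that] big_matrix_def frozen_entry_def col_sign_def col_class_def
          row_sign_def row_class_def)
    then show ?thesis by (intro exI[of _ "\<lambda>_. True"]) auto
  next
    case False
    obtain P :: "int \<Rightarrow> bool" where P:
      "(\<forall>x y. x \<le> y \<longrightarrow> P x \<longrightarrow> P y) \<or> (\<forall>x y. x \<le> y \<longrightarrow> P y \<longrightarrow> P x)"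
      "\<And>i. i \<in> row ` {..<n} \<Longrightarrow> row_sign m r \<Lambda> i * folding_sign m (X (Suc b - m))
          * free_entry m r \<Lambda> X i (Suc b - m) = of_bool (P (row_weight m r \<Lambda> i))"
    proof (rule free_entry_threshold[of "row ` {..<n}" m r \<Lambda> X "Suc b - m"])
      show "V m r \<Lambda> i > 0" if "i \<in> row ` {..<n}" for i
      proof -
        have "1 \<le> i" "i \<le> m + r" using that row_range by auto
        then have "0 \<le> \<Lambda> i" "int i \<le> int (m + r)" using nonneg by auto
        then show ?thesis
          unfolding V_def by (intro add_nonneg_pos add_nonneg_nonneg mult_nonneg_nonneg) auto
      qed
      show "row_class m r \<Lambda> i = folded_class m (X (Suc b - m))" if "i \<in> row ` {..<n}" for i
        using that pick b False by (auto simp: col_class_def)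
    qed (rule that)
    have "col B j $ a = of_bool (P (row_weight m r \<Lambda> (row a)))" if "a < n" for a
      using P(2)[of "row a"] that row_range[OF that] b False
      by (simp add: entry[OF that] big_matrix_def col_sign_def)
    with P(1) show ?thesis by blast
  qed
  then obtain P where P: "(\<forall>x y. x \<le> y \<longrightarrow> P x \<longrightarrow> P y) \<or> (\<forall>x y. x \<le> y \<longrightarrow> P y \<longrightarrow> P x)"
    "\<And>a. a < n \<Longrightarrow> col B j $ a = of_bool (P (row_weight m r \<Lambda> (row a)))"
    by blast
  show ?thesis
  proof (rule monotone_indicator_interval[where Q = "\<lambda>a. P (row_weight m r \<Lambda> (row a))"])
    show "col B j \<in> carrier_vec n" by (simp add: n carrier_vecI)
  qed (use P weight_mono j(2) in blast)+
qed

section \<open>The graph of an interval matrix\<close>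

lemma ex_column_graph:
  assumes "\<And>j. j < dim_col B \<Longrightarrow> col B j \<noteq> 0\<^sub>v (dim_row B) \<Longrightarrow>
    \<exists>a b. 1 \<le> a \<and> a \<le> b \<and> b \<le> dim_row B \<and> col B j = interval_vec (dim_row B) a b"
  shows "\<exists>G. is_column_graph B G"
proof -
  let ?n = "dim_row B"
  have "\<exists>u v. u \<in> {1..?n + 1} \<and> v \<in> {1..?n + 1} \<and>
      bdry (col B j) = basis_vec (?n + 1) u - basis_vec (?n + 1) v" if "j < dim_col B" for j
  proof (cases "col B j = 0\<^sub>v ?n")
    case True
    \<comment> \<open>A zero column is placed as a loop at vertex 1, which exists even when there
      are no rows.\<close>
    then have "bdry (col B j) = basis_vec (?n + 1) 1 - basis_vec (?n + 1) 1"
      using bdry_eq_0_iff[of "col B j" ?n] basis_vec_diff_eq_0_iff[of 1 "?n + 1" 1] by simp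
    then show ?thesis by (intro exI[of _ 1]) auto
  next
    case False
    then obtain a b where ab: "1 \<le> a" "a \<le> b" "b \<le> ?n" "col B j = interval_vec ?n a b"
      using assms \<open>j < dim_col B\<close> by blast
    then show ?thesis
      using bdry_interval_vec[OF ab(1-3)] by (intro exI[of _ a] exI[of _ "b + 1"]) auto
  qed
  then obtain t h where "\<And>j. j < dim_col B \<Longrightarrow> t j \<in> {1..?n + 1} \<and> h j \<in> {1..?n + 1} \<and>
      bdry (col B j) = basis_vec (?n + 1) (t j) - basis_vec (?n + 1) (h j)"
    by metis
  then have "is_column_graph B \<lparr>verts = {1..?n + 1}, arcs = {..<dim_col B}, tail = t, head = h\<rparr>"
    by (auto simp: is_column_graph_def wf_digraph_def)
  then show ?thesis by blast
qed

text \<open>The ends \<open>a\<close> and \<open>b + 1\<close> differ, so the image vector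
  determines them; all column graphs agree on this edge, wherever their loops are placed.\<close>

lemma column_graph_interval:
  assumes G: "is_column_graph B G" and j: "j < dim_col B"
    and ab: "1 \<le> a" "a \<le> b" "b \<le> dim_row B" "col B j = interval_vec (dim_row B) a b"
  shows "tail G j = a \<and> head G j = b + 1"
proof -
  have "bdry (col B j) =
      basis_vec (dim_row B + 1) (tail G j) - basis_vec (dim_row B + 1) (head G j)"
    using G j by (simp add: is_column_graph_def)
  moreover have "bdry (col B j) = basis_vec (dim_row B + 1) a - basis_vec (dim_row B + 1) (b + 1)"
    unfolding ab(4) by (rule bdry_interval_vec[OF ab(1-3)])
  moreover have "a \<in> {1..dim_row B + 1}" "b + 1 \<in> {1..dim_row B + 1}" "a \<noteq> b + 1"
    using ab(1-3) by auto
  ultimately show ?thesis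
    using basis_vec_diff_eq_iff[OF column_graph_ends[OF G j]] by metis
qed

lemma column_graph_loop_iff:
  assumes G: "is_column_graph B G" and j: "j < dim_col B"
  shows "tail G j = head G j \<longleftrightarrow> col B j = 0\<^sub>v (dim_row B)"
proof -
  have "bdry (col B j) =
      basis_vec (dim_row B + 1) (tail G j) - basis_vec (dim_row B + 1) (head G j)"
    using G j by (simp add: is_column_graph_def)
  then show ?thesis
    using basis_vec_diff_eq_0_iff[OF column_graph_ends[OF G j]]
      bdry_eq_0_iff[of "col B j" "dim_row B"] by simp
qed

theorem proposition5p29:
  fixes m' r c n :: nat and \<Lambda> X :: "nat \<Rightarrow> int" and B :: "int mat"
  assumes "modulus m' \<ge> 3" and "r \<ge> 2"
    and "\<And>i j. 1 \<le> i \<Longrightarrow> i \<le> j \<Longrightarrow> j \<le> m' + r \<Longrightarrow> \<Lambda> j \<le> \<Lambda> i"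
    and "\<And>i. 1 \<le> i \<Longrightarrow> i \<le> m' + r \<Longrightarrow> 0 \<le> \<Lambda> i"
    and "c \<le> m'"
    and "B = interval_block m' r \<Lambda> X c" and "n = dim_row B"
  shows
    "inj_on bdry (carrier_vec n) \<and>
     bij_betw bdry (carrier_vec n) (root_lattice n) \<and>
     (\<forall>x \<in> carrier_vec n. \<forall>y \<in> carrier_vec n. bdry (x + y) = bdry x + bdry y) \<and>
     (\<forall>y \<in> root_lattice n.
        the_inv_into (carrier_vec n) bdry y = vec n (\<lambda>k. \<Sum>i\<le>k. y $ i)) \<and>
     (\<forall>a b. 1 \<le> a \<and> a \<le> b \<and> b \<le> n \<longrightarrow>
        bdry (interval_vec n a b) = basis_vec (n + 1) a - basis_vec (n + 1) (b + 1)) \<and>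
     (\<forall>j < dim_col B. col B j \<noteq> 0\<^sub>v n \<longrightarrow>
        (\<exists>k. 1 \<le> k \<and> k < n \<and> col B j = interval_vec n 1 k) \<or>
        (\<exists>k. 1 \<le> k \<and> k < n \<and> col B j = interval_vec n (k + 1) n) \<or>
        col B j = interval_vec n 1 n) \<and>
     (\<exists>G. is_column_graph B G) \<and>
     (\<forall>G. is_column_graph B G \<longrightarrow>
        (\<forall>j < dim_col B.
           (\<forall>k. 1 \<le> k \<and> k < n \<and> col B j = interval_vec n 1 k \<longrightarrow>
              tail G j = 1 \<and> head G j = k + 1) \<and>
           (\<forall>k. 1 \<le> k \<and> k < n \<and> col B j = interval_vec n (k + 1) n \<longrightarrow>
              tail G j = k + 1 \<and> head G j = n + 1) \<and>
           (col B j \<noteq> 0\<^sub>v n \<and> col B j = interval_vec n 1 n \<longrightarrow>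
              tail G j = 1 \<and> head G j = n + 1) \<and>
           (tail G j = head G j \<longleftrightarrow> col B j = 0\<^sub>v n)) \<and>
        (\<forall>j \<in> arcs G. tail G j \<noteq> head G j \<longrightarrow> {tail G j, head G j} \<in> K2_plus_edges n) \<and>
        column_matroid B = cycle_matroid G \<and>
        (independent_columns B {..<dim_col B} \<longleftrightarrow> undirected_forest G))"
proof (intro conjI)
  show "inj_on bdry (carrier_vec n)" and "bij_betw bdry (carrier_vec n) (root_lattice n)"
    using bij_betw_bdry by (auto simp: bij_betw_def)
  show "\<forall>x\<in>carrier_vec n. \<forall>y\<in>carrier_vec n. bdry (x + y) = bdry x + bdry y"
    by (auto intro!: bdry_add)
  show "\<forall>y\<in>root_lattice n.
      the_inv_into (carrier_vec n) bdry y = vec n (\<lambda>k. \<Sum>i\<le>k. y $ i)"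
    by (simp add: the_inv_into_bdry)
  show "\<forall>a b. 1 \<le> a \<and> a \<le> b \<and> b \<le> n \<longrightarrow>
      bdry (interval_vec n a b) = basis_vec (n + 1) a - basis_vec (n + 1) (b + 1)"
    using bdry_interval_vec by blast
  have shape: "(\<exists>k. 1 \<le> k \<and> k < n \<and> col B j = interval_vec n 1 k) \<or>
      (\<exists>k. 1 \<le> k \<and> k < n \<and> col B j = interval_vec n (k + 1) n) \<or>
      col B j = interval_vec n 1 n" if "j < dim_col B" "col B j \<noteq> 0\<^sub>v n" for j
    using interval_block_col[OF assms(4,6,7) that] by simp
  then show "\<forall>j<dim_col B. col B j \<noteq> 0\<^sub>v n \<longrightarrow>
      (\<exists>k. 1 \<le> k \<and> k < n \<and> col B j = interval_vec n 1 k) \<or>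
      (\<exists>k. 1 \<le> k \<and> k < n \<and> col B j = interval_vec n (k + 1) n) \<or>
      col B j = interval_vec n 1 n"
    by blast
  \<comment> \<open>In dimension 0 every column is zero, so a nonzero column makes the interval
    \<open>[1, n]\<close> nonempty.\<close>
  have pos: "1 \<le> n" if "col B j \<noteq> 0\<^sub>v n" for j
    using that assms(7) by (cases n) auto
  show "\<exists>G. is_column_graph B G"
  proof (rule ex_column_graph)
    fix j assume "j < dim_col B" "col B j \<noteq> 0\<^sub>v (dim_row B)"
    then have j: "j < dim_col B" "col B j \<noteq> 0\<^sub>v n" by (simp_all add: assms(7))
    from shape[OF j] pos[OF j(2)]
    have "\<exists>a b. 1 \<le> a \<and> a \<le> b \<and> b \<le> n \<and> col B j = interval_vec n a b"
    proof (elim disjE exE conjE)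
      fix k assume "1 \<le> k" "k < n" "col B j = interval_vec n 1 k"
      then show ?thesis by (intro exI[of _ 1] exI[of _ k]) auto
    next
      fix k assume "1 \<le> k" "k < n" "col B j = interval_vec n (k + 1) n"
      then show ?thesis by (intro exI[of _ "k + 1"] exI[of _ n]) auto
    qed blast
    then show "\<exists>a b. 1 \<le> a \<and> a \<le> b \<and> b \<le> dim_row B \<and> col B j = interval_vec (dim_row B) a b"
      by (simp add: assms(7))
  qed
  show "\<forall>G. is_column_graph B G \<longrightarrow>
        (\<forall>j < dim_col B.
           (\<forall>k. 1 \<le> k \<and> k < n \<and> col B j = interval_vec n 1 k \<longrightarrow>
              tail G j = 1 \<and> head G j = k + 1) \<and>
           (\<forall>k. 1 \<le> k \<and> k < n \<and> col B j = interval_vec n (k + 1) n \<longrightarrow>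
              tail G j = k + 1 \<and> head G j = n + 1) \<and>
           (col B j \<noteq> 0\<^sub>v n \<and> col B j = interval_vec n 1 n \<longrightarrow>
              tail G j = 1 \<and> head G j = n + 1) \<and>
           (tail G j = head G j \<longleftrightarrow> col B j = 0\<^sub>v n)) \<and>
        (\<forall>j \<in> arcs G. tail G j \<noteq> head G j \<longrightarrow> {tail G j, head G j} \<in> K2_plus_edges n) \<and>
        column_matroid B = cycle_matroid G \<and>
        (independent_columns B {..<dim_col B} \<longleftrightarrow> undirected_forest G)"
    (is "\<forall>G. _ \<longrightarrow> (\<forall>j < dim_col B. ?prefix G j \<and> ?suffix G j \<and> ?full G j \<and> ?loop G j) \<and> ?K2 G \<and> _")
  proof (intro allI impI)
    fix G assume G: "is_column_graph B G"
    \<comment> \<open>Prefix, suffix and full column are the cases \<open>[1, k]\<close>,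
      \<open>[k + 1, n]\<close> and \<open>[1, n]\<close> of one interval.\<close>
    have ends: "tail G j = a \<and> head G j = b + 1"
      if "j < dim_col B" "1 \<le> a" "a \<le> b" "b \<le> n" "col B j = interval_vec n a b" for j a b
      using column_graph_interval[OF G that(1,2,3)] that assms(7) by simp
    have edges: "?prefix G j \<and> ?suffix G j \<and> ?full G j \<and> ?loop G j" if j: "j < dim_col B" for j
    proof (intro conjI allI impI)
      fix k assume "1 \<le> k \<and> k < n \<and> col B j = interval_vec n 1 k"
      then show "tail G j = 1" "head G j = k + 1" using ends[OF j, of 1 k] by auto
    next
      fix k assume "1 \<le> k \<and> k < n \<and> col B j = interval_vec n (k + 1) n"
      then show "tail G j = k + 1" "head G j = n + 1" using ends[OF j, of "k + 1" n] by auto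
    next
      assume "col B j \<noteq> 0\<^sub>v n \<and> col B j = interval_vec n 1 n"
      then show "tail G j = 1" "head G j = n + 1" using ends[OF j, of 1 n] pos[of j] by auto
    next
      show "?loop G j" using column_graph_loop_iff[OF G j] by (simp add: assms(7))
    qed
    have "?K2 G"
    proof (intro ballI impI)
      fix j assume "j \<in> arcs G" "tail G j \<noteq> head G j"
      then have j: "j < dim_col B" "col B j \<noteq> 0\<^sub>v n"
        using G edges by (auto simp: is_column_graph_def)
      \<comment> \<open>A non-loop is a nonzero column; in the first two cases the bounds on
        \<open>k\<close> put \<open>k + 1\<close> among the middle vertices
        \<open>{2..n}\<close>.\<close>
      from shape[OF j] consider
          k where "1 \<le> k" "k < n" "tail G j = 1" "head G j = k + 1"
        | k where "1 \<le> k" "k < n" "tail G j = k + 1" "head G j = n + 1"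
        | "tail G j = 1" "head G j = n + 1"
        using edges[OF j(1)] j(2) by blast
      then show "{tail G j, head G j} \<in> K2_plus_edges n"
      proof cases
        case (1 k)
        then show ?thesis unfolding K2_plus_edges_def complete_bipartite_edges_def
          by (intro UnI1 CollectI exI[of _ 1] exI[of _ "k + 1"]) auto
      next
        case (2 k)
        then show ?thesis unfolding K2_plus_edges_def complete_bipartite_edges_def
          by (intro UnI1 CollectI exI[of _ "n + 1"] exI[of _ "k + 1"]) auto
      next
        case 3
        then show ?thesis by (simp add: K2_plus_edges_def)
      qed
    qed
    then show "(\<forall>j < dim_col B. ?prefix G j \<and> ?suffix G j \<and> ?full G j \<and> ?loop G j) \<and> ?K2 G \<and>
        column_matroid B = cycle_matroid G \<and>
        (independent_columns B {..<dim_col B} \<longleftrightarrow> undirected_forest G)"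
      using edges column_matroid_eq_cycle_matroid[OF G] independent_columns_iff_forest[OF G]
      by blast
  qed
qed

end
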